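(* Let $n,k$ be positive integers with $n\ge 2k$ and let $0\le i\le k-1$. The generalized Johnson graph $J(n,k,i)$ exhibits perfect state transfer (for the Grover walk) if and only if $(n,k,i)=(2k,k,0)$ or $(n,k,i)=(4,2,1)$.
   Context: The generalized Johnson graph $J(n,k,i)$ has as vertices the $k$-subsets of $\{1,\dots,n\}$, two being adjacent iff their intersection has size exactly $i$. Grover walk: for a finite simple graph $G$ without isolated vertices, arcs $\mathcal{A}(G)=\{(u,v),(v,u):uv\in E(G)\}$, $t((u,v))=v$, $(u,v)^{-1}=(v,u)$; shift $S_{ab}=\delta_{a,b^{-1}}$; boundary $N_{ua}=\frac{1}{\sqrt{\deg u}}\delta_{u,t(a)}$; $U=S(2N^*N-I)$; $\Phi_u=N^*\mathbf{e}_u$. $G$ exhibits perfect state transfer if there are vertices $u\ne v$, a positive integer $\tau$ and a unimodular $\gamma$ with $U^\tau\Phi_u=\gamma\Phi_v$. *)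

theory Defs
  imports Complex_Main "Graph_Theory.Pair_Digraph"
begin

section \<open>Matrices indexed by arbitrary sets\<close>

text \<open>
  A complex matrix with rows indexed by \<open>I\<close> and columns indexed by \<open>J\<close> is a function
  of the two indices, of which only the values on \<open>I \<times> J\<close> matter. The finite
  index set that is summed over is an explicit parameter.
\<close>

definition index_mat_mult ::
    "'j set \<Rightarrow> ('i \<Rightarrow> 'j \<Rightarrow> complex) \<Rightarrow> ('j \<Rightarrow> 'l \<Rightarrow> complex) \<Rightarrow> 'i \<Rightarrow> 'l \<Rightarrow> complex" where
  "index_mat_mult J A B = (\<lambda>x z. \<Sum>y\<in>J. A x y * B y z)"

definition index_mat_vec ::
    "'j set \<Rightarrow> ('i \<Rightarrow> 'j \<Rightarrow> complex) \<Rightarrow> ('j \<Rightarrow> complex) \<Rightarrow> 'i \<Rightarrow> complex" where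
  "index_mat_vec J A v = (\<lambda>x. \<Sum>y\<in>J. A x y * v y)"

definition index_mat_one :: "'i \<Rightarrow> 'i \<Rightarrow> complex" where
  "index_mat_one = (\<lambda>x y. if x = y then 1 else 0)"

primrec index_mat_power :: "'i set \<Rightarrow> ('i \<Rightarrow> 'i \<Rightarrow> complex) \<Rightarrow> nat \<Rightarrow> 'i \<Rightarrow> 'i \<Rightarrow> complex" where
  "index_mat_power I A 0 = index_mat_one"
| "index_mat_power I A (Suc m) = index_mat_mult I A (index_mat_power I A m)"

definition index_mat_adjoint :: "('i \<Rightarrow> 'j \<Rightarrow> complex) \<Rightarrow> 'j \<Rightarrow> 'i \<Rightarrow> complex" where
  "index_mat_adjoint A = (\<lambda>y x. cnj (A x y))"


section \<open>The Grover walk\<close>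

text \<open>
  A finite simple graph is a \<^locale>\<open>pair_graph\<close>: a finite loopless digraph whose arcs
  are ordered pairs of vertices and whose arc set is symmetric, so that \<open>parcs G\<close> is the set of
  the arcs \<open>(u, v)\<close> and \<open>(v, u)\<close> for all edges \<open>uv\<close>. The terminus of an arc is its second
  component, and the degree of a vertex is the number of arcs leaving it. The definitions below
  are intended for such graphs without isolated vertices.
\<close>

definition grover_shift :: "'a \<times> 'a \<Rightarrow> 'a \<times> 'a \<Rightarrow> complex" where
  "grover_shift = (\<lambda>a b. if a = prod.swap b then 1 else 0)"

definition grover_boundary :: "'a pair_pre_digraph \<Rightarrow> 'a \<Rightarrow> 'a \<times> 'a \<Rightarrow> complex" where
  "grover_boundary G = (\<lambda>u a.
     of_real (1 / sqrt (real (out_degree (with_proj G) u))) * (if u = snd a then 1 else 0))"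

definition grover_evolution :: "'a pair_pre_digraph \<Rightarrow> 'a \<times> 'a \<Rightarrow> 'a \<times> 'a \<Rightarrow> complex" where
  "grover_evolution G = index_mat_mult (parcs G) grover_shift
     (\<lambda>a b. 2 * index_mat_mult (pverts G)
                   (index_mat_adjoint (grover_boundary G)) (grover_boundary G) a b
            - index_mat_one a b)"

definition grover_vertex_state :: "'a pair_pre_digraph \<Rightarrow> 'a \<Rightarrow> 'a \<times> 'a \<Rightarrow> complex" where
  "grover_vertex_state G u = index_mat_vec (pverts G)
     (index_mat_adjoint (grover_boundary G)) (\<lambda>w. if w = u then 1 else 0)"

definition grover_perfect_state_transfer :: "'a pair_pre_digraph \<Rightarrow> bool" where
  "grover_perfect_state_transfer G \<longleftrightarrow>
     (\<exists>u\<in>pverts G. \<exists>v\<in>pverts G. u \<noteq> v \<and>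
       (\<exists>(\<tau>::nat) (\<gamma>::complex). \<tau> > 0 \<and> cmod \<gamma> = 1 \<and>
         (\<forall>a\<in>parcs G.
            index_mat_vec (parcs G) (index_mat_power (parcs G) (grover_evolution G) \<tau>)
              (grover_vertex_state G u) a
            = \<gamma> * grover_vertex_state G v a)))"


section \<open>Generalized Johnson graphs\<close>

text \<open>
  The condition \<open>A \<noteq> B\<close> only matters for \<open>i = k\<close>, where it excludes loops.
\<close>

definition generalized_johnson_graph :: "nat \<Rightarrow> nat \<Rightarrow> nat \<Rightarrow> nat set pair_pre_digraph" where
  "generalized_johnson_graph n k i =
     (let V = {A. A \<subseteq> {1..n} \<and> card A = k}
      in \<lparr> pverts = V, parcs = {(A, B). A \<in> V \<and> B \<in> V \<and> A \<noteq> B \<and> card (A \<inter> B) = i} \<rparr>)"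

lemma pair_graph_generalized_johnson_graph: "pair_graph (generalized_johnson_graph n k i)"
proof -
  let ?G = "generalized_johnson_graph n k i"
  have fin: "finite (pverts ?G)"
    by (simp add: generalized_johnson_graph_def)
  have sub: "parcs ?G \<subseteq> pverts ?G \<times> pverts ?G"
    by (auto simp: generalized_johnson_graph_def Let_def)
  have sym: "symmetric (with_proj ?G)"
    by (auto simp: symmetric_def sym_def generalized_johnson_graph_def Let_def Int_commute)
  have finarcs: "finite (parcs ?G)"
    by (rule finite_subset[OF sub finite_cartesian_product[OF fin fin]])
  have noloop: "fst e \<noteq> snd e" if "e \<in> parcs ?G" for e
    using that unfolding generalized_johnson_graph_def Let_def by (cases e) simp
  have ends: "fst e \<in> pverts ?G" "snd e \<in> pverts ?G" if "e \<in> parcs ?G" for e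
    using subsetD[OF sub that] by (simp_all only: mem_Times_iff)
  show ?thesis
    by unfold_locales (fact ends fin finarcs noloop sym)+
qed

lemma generalized_johnson_graph_no_isolated_vertex:
  assumes "2 * k \<le> n" "i < k" "A \<in> pverts (generalized_johnson_graph n k i)"
  shows "\<exists>B. (A, B) \<in> parcs (generalized_johnson_graph n k i)"
proof -
  have A: "A \<subseteq> {1..n}" "card A = k"
    using assms(3) by (auto simp: generalized_johnson_graph_def)
  have finA: "finite A"
    by (rule finite_subset[OF A(1)]) simp
  obtain C where C: "C \<subseteq> A" "card C = i"
    using assms(2) A(2) obtain_subset_with_card_n[of i A] by auto
  have "k - i \<le> card ({1..n} - A)"
    using A assms(1) finA by (simp add: card_Diff_subset)
  then obtain D where D: "D \<subseteq> {1..n} - A" "card D = k - i"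
    using obtain_subset_with_card_n[of "k - i" "{1..n} - A"] by auto
  have fin: "finite C" "finite D"
    using C(1) D(1) finA by (auto intro: finite_subset)
  have "C \<inter> D = {}"
    using C(1) D(1) by blast
  then have card: "card (C \<union> D) = k"
    using fin C(2) D(2) assms(2) by (simp add: card_Un_disjoint)
  have int: "A \<inter> (C \<union> D) = C"
    using C(1) D(1) by blast
  then have "A \<noteq> C \<union> D"
    using A(2) C(2) assms(2) by auto
  then have "(A, C \<union> D) \<in> parcs (generalized_johnson_graph n k i)"
    using A C D card int by (auto simp: generalized_johnson_graph_def Let_def)
  then show ?thesis ..
qed

end

(*
  Applying the boundary operator to U^t Phi_u gives T_t(P) e_u, where P is the normalized
  adjacency matrix and T_t the Chebyshev polynomial. If f is an eigenvector of P for l, perfect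
  state transfer from u to v at time t therefore gives gamma f(v) = T_t(l) f(u), and the constant
  eigenvector gives gamma = 1. The eigenvectors [a notin A] - [b notin A] share one eigenvalue;
  letting a and b vary forces v to be the complement of u, so n = 2k, and T_t(l) = -1.
  Products of two such differences give a second rational eigenvalue with T_t(l) = 1. Since 2 T_t
  is monic and integral in 2l, both doubled eigenvalues are integers, and this leaves only the two
  families. Conversely J(2k,k,0) is a perfect matching, with transfer at time 1, and J(4,2,1) is
  the octahedron, with transfer at time 6.
*)

theory Submission
  imports Defs
begin

section \<open>Chebyshev polynomials of the first kind\<close>

fun chebyshev :: "nat \<Rightarrow> 'a::comm_ring_1 \<Rightarrow> 'a" where
  "chebyshev 0 x = 1"
| "chebyshev (Suc 0) x = x"
| "chebyshev (Suc (Suc t)) x = 2 * x * chebyshev (Suc t) x - chebyshev t x"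

lemma chebyshev_one: "chebyshev t 1 = 1"
  by (induction t "1::'a" rule: chebyshev.induct) auto

text \<open>
  A form of Niven's theorem: twice the Chebyshev polynomial is a monic integral polynomial
  in \<open>2 x\<close>, so the rational root theorem applies.
\<close>

lemma chebyshev_integral:
  fixes x :: "'a::field_char_0"
  assumes "2 * x \<in> \<rat>" "t > 0" "chebyshev t x \<in> \<int>"
  shows "2 * x \<in> \<int>"
proof -
  obtain a b :: int where ab: "b > 0" "coprime a b" "2 * x = of_int a / of_int b"
    using assms(1) by (rule Rats_cases')
  have x: "of_int b * (2 * x) = of_int a"
    using ab by simp
  \<comment> \<open>After clearing denominators the leading term \<open>a ^ Suc t\<close> survives
    modulo b. The recursion reaches back two indices, so integrality at t is carried along. The
    congruence starts at index 1: at index 0 it would read 2 = 1 modulo b.\<close>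
  have "\<exists>q. of_int b ^ Suc t * (2 * chebyshev (Suc t) x) = of_int (a ^ Suc t + b * q) \<and>
      (\<exists>p. of_int b ^ t * (2 * chebyshev t x) = of_int p)" for t
  proof (induction t)
    case 0
    show ?case
      using x by (intro exI[of _ 0] conjI exI[of _ 2]) auto
  next
    case (Suc t)
    then obtain q p where q: "of_int b ^ Suc t * (2 * chebyshev (Suc t) x) = of_int (a ^ Suc t + b * q)"
      and p: "of_int b ^ t * (2 * chebyshev t x) = of_int p"
      by blast
    have "of_int b ^ Suc (Suc t) * (2 * chebyshev (Suc (Suc t)) x) =
      (of_int b * (2 * x)) * (of_int b ^ Suc t * (2 * chebyshev (Suc t) x))
        - of_int b ^ 2 * (of_int b ^ t * (2 * chebyshev t x))"
      by (simp add: algebra_simps power2_eq_square)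
    also have "\<dots> = of_int (a ^ Suc (Suc t) + b * (a * q - b * p))"
      unfolding q p x by (simp add: algebra_simps power2_eq_square)
    finally show ?case
      using q by blast
  qed
  from this[of "t - 1"] assms(2) obtain q
    where q: "of_int b ^ t * (2 * chebyshev t x) = of_int (a ^ t + b * q)"
    by auto
  obtain c where c: "chebyshev t x = of_int c"
    using assms(3) by (auto elim: Ints_cases)
  have "of_int (b ^ t * (2 * c)) = (of_int (a ^ t + b * q) :: 'a)"
    using q unfolding c by simp
  \<comment> \<open>If the value is an integer, b divides the left side because t > 0, hence b
    divides \<open>a ^ t\<close>; coprimality then leaves only b = 1.\<close>
  then have "b ^ t * (2 * c) = a ^ t + b * q"
    by (simp only: of_int_eq_iff)
  moreover have "b dvd b ^ t * (2 * c)"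
    using assms(2) by (simp add: dvd_power)
  ultimately have "b dvd a ^ t"
    by (metis dvd_add_left_iff dvd_triv_left)
  moreover have "coprime (a ^ t) b"
    using ab(2) by simp
  ultimately have "b = 1"
    using ab(1) by (metis coprime_absorb_right is_unit_normalize normalize_int_def abs_of_pos coprime_commute zdvd1_eq)
  then show ?thesis
    using ab(3) by simp
qed


section \<open>The Grover walk on a regular graph\<close>

definition nbrs :: "'a pair_pre_digraph \<Rightarrow> 'a \<Rightarrow> 'a set" where
  "nbrs G w = {z. (w, z) \<in> parcs G}"

text \<open>Regularity makes all nonzero entries of the boundary matrix equal to 1 / sqrt d, so that
  the boundary operator, the shift and the adjoint boundary compose to the adjacency matrix divided
  by d. Positivity of d excludes isolated vertices.\<close>

locale regular_pair_graph = pair_graph G for G :: "'a pair_pre_digraph" +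
  fixes d :: nat
  assumes d_pos: "d > 0"
    and regular: "w \<in> pverts G \<Longrightarrow> card (nbrs G w) = d"
begin

lemma arc_sym: "(a, b) \<in> parcs G \<longleftrightarrow> (b, a) \<in> parcs G"
  using sym_arcs by (auto simp: symmetric_def sym_def)

lemma nbrs_sym: "z \<in> nbrs G w \<longleftrightarrow> w \<in> nbrs G z"
  by (simp add: nbrs_def arc_sym)

lemma nbrs_subset: "nbrs G w \<subseteq> pverts G"
  by (auto simp: nbrs_def dest: in_arcsD2)

lemma out_degree_eq:
  assumes "w \<in> pverts G"
  shows "out_degree (with_proj G) w = d"
proof -
  have "out_arcs (with_proj G) w = Pair w ` nbrs G w"
    by (auto simp: out_arcs_def nbrs_def)
  then have "out_degree (with_proj G) w = card (Pair w ` nbrs G w)"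
    by (simp add: out_degree_def)
  also have "\<dots> = card (nbrs G w)"
    by (rule card_image) (auto simp: inj_on_def)
  finally show ?thesis
    using regular[OF assms] by simp
qed

section \<open>The evolution in coordinates and the recurrence for the vertex amplitudes\<close>

definition isd :: complex where
  "isd = of_real (1 / sqrt (real d))"

lemma isd_sq: "isd * isd = 1 / of_nat d"
  by (simp add: isd_def flip: of_real_mult)

lemma d_isd_sq: "of_nat d * (isd * isd) = 1"
  using d_pos by (simp add: isd_sq)

lemma boundary_eq:
  "w \<in> pverts G \<Longrightarrow> grover_boundary G w a = (if w = snd a then isd else 0)"
  by (simp add: grover_boundary_def isd_def out_degree_eq)

lemma vertex_state_eq:
  assumes "u \<in> pverts G"
  shows "grover_vertex_state G u a = (if u = snd a then isd else 0)"
proof -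
  have "grover_vertex_state G u a =
      (\<Sum>w\<in>pverts G. if w = u then cnj (grover_boundary G w a) else 0)"
    unfolding grover_vertex_state_def index_mat_vec_def index_mat_adjoint_def
    by (intro sum.cong) auto
  also have "\<dots> = cnj (grover_boundary G u a)"
    using assms by simp
  finally show ?thesis
    using assms by (simp add: boundary_eq isd_def)
qed

definition walk :: "'a \<Rightarrow> nat \<Rightarrow> 'a \<times> 'a \<Rightarrow> complex" where
  "walk u t = index_mat_vec (parcs G) (index_mat_power (parcs G) (grover_evolution G) t)
     (grover_vertex_state G u)"

text \<open>The vector \<open>N U\<^sup>t \<Phi>\<^sub>u\<close>.\<close>

definition amp :: "'a \<Rightarrow> nat \<Rightarrow> 'a \<Rightarrow> complex" where
  "amp u t w = isd * (\<Sum>z\<in>nbrs G w. walk u t (z, w))"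

lemma walk_0:
  assumes "u \<in> pverts G" "a \<in> parcs G"
  shows "walk u 0 a = (if u = snd a then isd else 0)"
proof -
  have "walk u 0 a = (\<Sum>b\<in>parcs G. if a = b then grover_vertex_state G u b else 0)"
    unfolding walk_def index_mat_vec_def index_mat_power.simps index_mat_one_def
    by (intro sum.cong) auto
  also have "\<dots> = grover_vertex_state G u a"
    using assms by simp
  finally show ?thesis
    using assms by (simp add: vertex_state_eq)
qed

lemma sum_arcs_into:
  "(\<Sum>b\<in>parcs G. if w = snd b then g b else 0) = (\<Sum>z\<in>nbrs G w. g (z, w))"
proof -
  have "(\<Sum>b\<in>parcs G. if w = snd b then g b else 0) = (\<Sum>b\<in>{b\<in>parcs G. w = snd b}. g b)"
    by (simp add: sum.inter_filter)
  also have "{b\<in>parcs G. w = snd b} = (\<lambda>z. (z, w)) ` nbrs G w"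
    by (auto simp: nbrs_def arc_sym)
  also have "(\<Sum>b\<in>(\<lambda>z. (z, w)) ` nbrs G w. g b) = (\<Sum>z\<in>nbrs G w. g (z, w))"
    by (subst sum.reindex) (auto simp: inj_on_def)
  finally show ?thesis .
qed

text \<open>The shift makes row (a, b) of U equal to row (b, a) of the reflection, and the
  reflection couples only arcs with the same terminus, here a.\<close>

lemma evolution_eq:
  assumes "(a, b) \<in> parcs G"
  shows "grover_evolution G (a, b) c =
    2 * (if a = snd c then isd * isd else 0) - (if c = (b, a) then 1 else 0)"
proof -
  let ?M = "\<lambda>a b. 2 * index_mat_mult (pverts G)
                   (index_mat_adjoint (grover_boundary G)) (grover_boundary G) a b
            - index_mat_one a b"
  have V: "a \<in> pverts G"
    using assms by (auto dest: in_arcsD1)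
  have "grover_evolution G (a, b) c = (\<Sum>y\<in>parcs G. if y = (b, a) then ?M y c else 0)"
    unfolding grover_evolution_def index_mat_mult_def grover_shift_def
    by (intro sum.cong) auto
  also have "\<dots> = ?M (b, a) c"
    using assms arc_sym by simp
  also have "index_mat_mult (pverts G)
      (index_mat_adjoint (grover_boundary G)) (grover_boundary G) (b, a) c =
      (\<Sum>w\<in>pverts G. if w = a then (if a = snd c then isd * isd else 0) else 0)"
    unfolding index_mat_mult_def index_mat_adjoint_def
    by (intro sum.cong) (auto simp: boundary_eq isd_def)
  also have "\<dots> = (if a = snd c then isd * isd else 0)"
    using V by simp
  finally show ?thesis
    by (auto simp: index_mat_one_def)
qed

text \<open>The reflection sends the value at (b, a) to twice the mean over the arcs into a minus
  that value; the shift then moves the result to (a, b).\<close>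

lemma walk_Suc:
  assumes "(a, b) \<in> parcs G"
  shows "walk u (Suc t) (a, b) = 2 * isd * amp u t a - walk u t (b, a)"
proof -
  let ?E = "grover_evolution G" and ?P = "index_mat_power (parcs G) (grover_evolution G) t"
  have "walk u (Suc t) (a, b) = (\<Sum>c\<in>parcs G. ?E (a, b) c * walk u t c)"
    unfolding walk_def index_mat_vec_def index_mat_power.simps index_mat_mult_def
    by (simp add: sum_distrib_left sum_distrib_right mult.assoc) (rule sum.swap)
  also have "\<dots> = (\<Sum>c\<in>parcs G. 2 * (isd * isd) * (if a = snd c then walk u t c else 0)
      - (if c = (b, a) then walk u t c else 0))"
    by (intro sum.cong) (auto simp: evolution_eq[OF assms] algebra_simps)
  also have "\<dots> = 2 * (isd * isd) * (\<Sum>z\<in>nbrs G a. walk u t (z, a)) - walk u t (b, a)"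
    using assms arc_sym by (simp add: sum_subtractf sum_arcs_into flip: sum_distrib_left)
  finally show ?thesis
    by (simp add: amp_def)
qed

text \<open>The boundary operator times its adjoint is the identity: d arcs enter u and each
  contributes \<open>isd * isd\<close>, that is 1 / d.\<close>

lemma amp_0:
  assumes "u \<in> pverts G" "w \<in> pverts G"
  shows "amp u 0 w = (if w = u then 1 else 0)"
proof -
  have "(\<Sum>z\<in>nbrs G w. walk u 0 (z, w)) = (\<Sum>z\<in>nbrs G w. if u = w then isd else 0)"
    using assms(1) by (intro sum.cong) (auto simp: walk_0 nbrs_def arc_sym)
  then show ?thesis
    using assms regular d_isd_sq by (auto simp: amp_def algebra_simps)
qed

text \<open>Stepping the arcs into w leaves a sum over the arcs out of w, which is not an amplitude.
  The next two lemmas eliminate it, at time 0 from the initial state and later by one more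
  step.\<close>

lemma amp_Suc:
  assumes "w \<in> pverts G"
  shows "amp u (Suc t) w =
    2 / of_nat d * (\<Sum>z\<in>nbrs G w. amp u t z) - isd * (\<Sum>z\<in>nbrs G w. walk u t (w, z))"
proof -
  have "(\<Sum>z\<in>nbrs G w. walk u (Suc t) (z, w)) =
      (\<Sum>z\<in>nbrs G w. 2 * isd * amp u t z - walk u t (w, z))"
    by (intro sum.cong walk_Suc) (auto simp: nbrs_def arc_sym)
  also have "\<dots> = 2 * isd * (\<Sum>z\<in>nbrs G w. amp u t z) - (\<Sum>z\<in>nbrs G w. walk u t (w, z))"
    by (simp only: sum_subtractf sum_distrib_left)
  finally have "amp u (Suc t) w = 2 * (isd * isd) * (\<Sum>z\<in>nbrs G w. amp u t z)
      - isd * (\<Sum>z\<in>nbrs G w. walk u t (w, z))"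
    unfolding amp_def[of u "Suc t"] by (simp only: right_diff_distrib ac_simps)
  then show ?thesis
    by (simp add: isd_sq)
qed

text \<open>The initial state is constant on the arcs into each vertex, so the outgoing sum cancels
  half of the first term. This is why the first step has coefficient 1, matching T_1(x) = x, while
  later ones have coefficient 2.\<close>

lemma amp_Suc_0:
  assumes "u \<in> pverts G" "w \<in> pverts G"
  shows "amp u (Suc 0) w = 1 / of_nat d * (\<Sum>z\<in>nbrs G w. amp u 0 z)"
proof -
  have "(\<Sum>z\<in>nbrs G w. walk u 0 (w, z)) = isd * (\<Sum>z\<in>nbrs G w. amp u 0 z)"
    unfolding sum_distrib_left
    using assms nbrs_subset by (intro sum.cong) (auto simp: walk_0 nbrs_def amp_0 dest: in_arcsD2)
  then have "isd * (\<Sum>z\<in>nbrs G w. walk u 0 (w, z)) = 1 / of_nat d * (\<Sum>z\<in>nbrs G w. amp u 0 z)"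
    by (simp add: isd_sq flip: mult.assoc)
  then show ?thesis
    unfolding amp_Suc[OF assms(2)] by (simp add: algebra_simps)
qed

text \<open>Resolving the outgoing sum by a further step yields 2 \<open>amp u t w\<close> -
  \<open>amp u t w\<close>, which leaves exactly the three-term Chebyshev recurrence for the
  normalized adjacency operator.\<close>

lemma amp_Suc_Suc:
  assumes "w \<in> pverts G"
  shows "amp u (Suc (Suc t)) w = 2 / of_nat d * (\<Sum>z\<in>nbrs G w. amp u (Suc t) z) - amp u t w"
proof -
  have "(\<Sum>z\<in>nbrs G w. walk u (Suc t) (w, z)) =
      (\<Sum>z\<in>nbrs G w. 2 * isd * amp u t w - walk u t (z, w))"
    by (intro sum.cong walk_Suc) (auto simp: nbrs_def)
  also have "\<dots> = 2 * of_nat d * isd * amp u t w - (\<Sum>z\<in>nbrs G w. walk u t (z, w))"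
    using assms regular by (simp add: sum_subtractf)
  finally have "isd * (\<Sum>z\<in>nbrs G w. walk u (Suc t) (w, z)) =
      2 * (of_nat d * (isd * isd)) * amp u t w - isd * (\<Sum>z\<in>nbrs G w. walk u t (z, w))"
    by (simp only: right_diff_distrib ac_simps)
  then have "isd * (\<Sum>z\<in>nbrs G w. walk u (Suc t) (w, z)) = 2 * amp u t w - amp u t w"
    by (simp only: d_isd_sq mult_1_right flip: amp_def)
  then show ?thesis
    unfolding amp_Suc[OF assms, of _ "Suc t"] by simp
qed

section \<open>Pairing the amplitudes with eigenvectors of the self-adjoint adjacency
  operator\<close>

lemma sum_nbrs_swap:
  fixes f g :: "'a \<Rightarrow> complex"
  shows "(\<Sum>w\<in>pverts G. f w * (\<Sum>z\<in>nbrs G w. g z)) = (\<Sum>z\<in>pverts G. (\<Sum>w\<in>nbrs G z. f w) * g z)"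
proof -
  have nb: "(\<Sum>z\<in>nbrs G w. h z) = (\<Sum>z\<in>pverts G. if z \<in> nbrs G w then h z else 0)"
    for h :: "'a \<Rightarrow> complex" and w
    using nbrs_subset[of w] by (simp add: sum.inter_restrict[symmetric] Int_absorb1)
  have "(\<Sum>w\<in>pverts G. f w * (\<Sum>z\<in>nbrs G w. g z)) =
      (\<Sum>w\<in>pverts G. \<Sum>z\<in>pverts G. if z \<in> nbrs G w then f w * g z else 0)"
    unfolding nb sum_distrib_left by (intro sum.cong) auto
  also have "\<dots> = (\<Sum>z\<in>pverts G. \<Sum>w\<in>pverts G. if z \<in> nbrs G w then f w * g z else 0)"
    by (rule sum.swap)
  also have "\<dots> = (\<Sum>z\<in>pverts G. (\<Sum>w\<in>nbrs G z. f w) * g z)"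
    unfolding nb sum_distrib_right by (intro sum.cong) (auto simp: nbrs_sym)
  finally show ?thesis .
qed

text \<open>Moving the adjacency operator onto f turns the recurrence into a scalar one, so
  polynomials of matrices never appear. The eigenvalue is written d l so that l belongs to the
  normalized operator; the pairing involves no conjugation.\<close>

lemma sum_eigenvector_amp:
  assumes eigen: "\<And>w. w \<in> pverts G \<Longrightarrow> (\<Sum>z\<in>nbrs G w. f z) = of_nat d * l * f w"
    and u: "u \<in> pverts G"
  shows "(\<Sum>w\<in>pverts G. f w * amp u t w) = chebyshev t l * f u"
proof -
  have step: "(\<Sum>w\<in>pverts G. f w * (c / of_nat d * (\<Sum>z\<in>nbrs G w. g z))) =
      c * l * (\<Sum>w\<in>pverts G. f w * g w)" for c g
  proof -
    have "(\<Sum>w\<in>pverts G. f w * (c / of_nat d * (\<Sum>z\<in>nbrs G w. g z))) =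
        c / of_nat d * (\<Sum>w\<in>pverts G. f w * (\<Sum>z\<in>nbrs G w. g z))"
      by (simp only: mult.left_commute[of _ "c / of_nat d"] flip: sum_distrib_left)
    also have "\<dots> = c / of_nat d * (\<Sum>w\<in>pverts G. of_nat d * l * (f w * g w))"
      unfolding sum_nbrs_swap by (simp add: eigen algebra_simps)
    also have "\<dots> = c * l * (\<Sum>w\<in>pverts G. f w * g w)"
      using d_pos by (simp flip: sum_distrib_left)
    finally show ?thesis .
  qed
  show ?thesis
  proof (induction t rule: induct_nat_012)
    case 0
    have "(\<Sum>w\<in>pverts G. f w * amp u 0 w) = (\<Sum>w\<in>pverts G. if w = u then f w else 0)"
      using u by (intro sum.cong) (auto simp: amp_0)
    then show ?case
      using u by simp
  next
    case 1
    have "(\<Sum>w\<in>pverts G. f w * amp u 0 w) = (\<Sum>w\<in>pverts G. if w = u then f w else 0)"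
      using u by (intro sum.cong) (auto simp: amp_0)
    then show ?case
      using u step[of 1 "amp u 0"] by (simp add: amp_Suc_0)
  next
    case (ge2 t)
    have "(\<Sum>w\<in>pverts G. f w * amp u (Suc (Suc t)) w) =
      (\<Sum>w\<in>pverts G. f w * (2 / of_nat d * (\<Sum>z\<in>nbrs G w. amp u (Suc t) z)))
        - (\<Sum>w\<in>pverts G. f w * amp u t w)"
      by (simp add: amp_Suc_Suc right_diff_distrib sum_subtractf)
    then show ?case
      unfolding step ge2 by (simp add: algebra_simps)
  qed
qed

text \<open>Applying the boundary operator to the transferred state concentrates the amplitudes at
  v, and pairing with f extracts one scalar identity. The same u, v and t serve every eigenvector,
  so identities for different eigenvectors can be combined.\<close>

lemma perfect_state_transfer_eigenvector:
  assumes "grover_perfect_state_transfer G"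
  obtains u v t where "u \<in> pverts G" "v \<in> pverts G" "u \<noteq> v" "t > 0"
    "\<And>(f :: 'a \<Rightarrow> complex) l. (\<And>w. w \<in> pverts G \<Longrightarrow> (\<Sum>z\<in>nbrs G w. f z) = of_nat d * l * f w) \<Longrightarrow>
       f v = chebyshev t l * f u"
proof -
  obtain u v t \<gamma> where u: "u \<in> pverts G" and v: "v \<in> pverts G" and "u \<noteq> v" "t > 0"
    and w: "\<And>a. a \<in> parcs G \<Longrightarrow> walk u t a = \<gamma> * grover_vertex_state G v a"
    using assms unfolding grover_perfect_state_transfer_def walk_def by metis
  have amp: "amp u t w = (if w = v then \<gamma> else 0)" if "w \<in> pverts G" for w
  proof -
    have "(\<Sum>z\<in>nbrs G w. walk u t (z, w)) = (\<Sum>z\<in>nbrs G w. if w = v then \<gamma> * isd else 0)"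
      using v by (intro sum.cong) (auto simp: w vertex_state_eq nbrs_def arc_sym)
    then show ?thesis
      using that regular d_isd_sq by (auto simp: amp_def algebra_simps)
  qed
  have *: "chebyshev t l * f u = \<gamma> * f v"
    if "\<And>w. w \<in> pverts G \<Longrightarrow> (\<Sum>z\<in>nbrs G w. f z) = of_nat d * l * f w" for f l
  proof -
    have "chebyshev t l * f u = (\<Sum>w\<in>pverts G. f w * amp u t w)"
      using sum_eigenvector_amp[OF that u] by simp
    also have "\<dots> = (\<Sum>w\<in>pverts G. if w = v then \<gamma> * f w else 0)"
      by (intro sum.cong) (auto simp: amp)
    finally show ?thesis
      using v by simp
  qed
  have "\<gamma> = 1"
    using *[of "\<lambda>_. 1" 1] regular by (simp add: chebyshev_one)
  then show ?thesis
    using * by (intro that[OF u v \<open>u \<noteq> v\<close> \<open>t > 0\<close>]) simp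
qed

section \<open>Sufficient criteria for transfer, all with phase 1\<close>

lemma perfect_state_transferI:
  assumes "u \<in> pverts G" "v \<in> pverts G" "u \<noteq> v" "t > 0"
    and "\<And>a b. (a, b) \<in> parcs G \<Longrightarrow> walk u t (a, b) = (if b = v then isd else 0)"
  shows "grover_perfect_state_transfer G"
proof -
  have "\<forall>a\<in>parcs G. walk u t a = 1 * grover_vertex_state G v a"
    using assms by (auto simp: vertex_state_eq)
  then show ?thesis
    unfolding grover_perfect_state_transfer_def walk_def
    using assms(1-4) by (metis norm_one)
qed

text \<open>When d = 1 the reflection is the identity and U is just the shift. The state of u lives
  on the single arc into u, and reversing that arc gives the state of its partner.\<close>

lemma perfect_state_transfer_matching:
  assumes "d = 1" and u: "u \<in> pverts G"
  shows "grover_perfect_state_transfer G"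
proof -
  have unique: "z = z'" if "z \<in> nbrs G w" "z' \<in> nbrs G w" for w z z'
  proof -
    have "w \<in> pverts G"
      using that nbrs_subset nbrs_sym by blast
    then have "card (nbrs G w) = 1"
      using regular assms(1) by simp
    then show ?thesis
      using that by (auto simp: card_1_singleton_iff)
  qed
  obtain v where v: "v \<in> nbrs G u"
    using regular[OF u] assms(1) by (auto simp: card_1_singleton_iff)
  show ?thesis
  proof (rule perfect_state_transferI[where t = 1])
    show "u \<in> pverts G" by (rule u)
    show "v \<in> pverts G"
      using v nbrs_subset by blast
    show "u \<noteq> v"
      using v pair_no_loops[of "(u, u)"] by (auto simp: nbrs_def)
    fix a b assume ab: "(a, b) \<in> parcs G"
    then have b: "b \<in> nbrs G a" and a: "a \<in> nbrs G b"
      using arc_sym by (auto simp: nbrs_def)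
    have "a = u \<longleftrightarrow> b = v"
      using a b v unique nbrs_sym by blast
    moreover have "a \<in> pverts G" "(b, a) \<in> parcs G"
      using ab arc_sym by (auto dest: in_arcsD1)
    moreover have "isd = 1"
      by (subst isd_def) (simp add: assms(1))
    ultimately show "walk u 1 (a, b) = (if b = v then isd else 0)"
      using u by (auto simp: walk_Suc[OF ab] walk_0 amp_0)
  qed simp
qed

text \<open>The constant eigenvector gives a conserved total. When a neighbourhood omits only two
  vertices, this expresses its sum by the amplitudes at those two.\<close>

lemma sum_amp:
  assumes "u \<in> pverts G"
  shows "(\<Sum>w\<in>pverts G. amp u t w) = 1"
  using sum_eigenvector_amp[of "\<lambda>_. 1" 1 u t] assms regular by (simp add: chebyshev_one)

text \<open>The hypotheses describe the octahedron with antipodal map c. Its normalized eigenvalues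
  are 1 and -1/2 on functions symmetric under c and 0 on antisymmetric ones. The least t with T_t(1)
  = T_t(-1/2) = 1 and T_t(0) = -1 is 6, and there T_t of the operator is the antipodal map. The
  proof unrolls the recurrence explicitly.\<close>

lemma perfect_state_transfer_octahedron:
  assumes "d = 4" and u: "u \<in> pverts G"
    and antipode: "\<And>w. w \<in> pverts G \<Longrightarrow> c w \<in> pverts G \<and> c w \<noteq> w \<and> c (c w) = w"
    and nbrs: "\<And>w. w \<in> pverts G \<Longrightarrow> nbrs G w = pverts G - {w, c w}"
  shows "grover_perfect_state_transfer G"
proof -
  have sum_nbrs: "(\<Sum>z\<in>nbrs G w. amp u t z) = 1 - amp u t w - amp u t (c w)"
    if "w \<in> pverts G" for w t
  proof -
    have "(\<Sum>z\<in>nbrs G w. amp u t z) = (\<Sum>z\<in>pverts G. amp u t z) - (\<Sum>z\<in>{w, c w}. amp u t z)"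
      unfolding nbrs[OF that] using that antipode[OF that] by (intro sum_diff) auto
    then show ?thesis
      using sum_amp[OF u] antipode[OF that] by auto
  qed
  have y1: "amp u (Suc 0) w = (1 - amp u 0 w - amp u 0 (c w)) / 4" if "w \<in> pverts G" for w
    using amp_Suc_0[OF u that] sum_nbrs[OF that] assms(1) by simp
  have yS: "amp u (Suc (Suc t)) w = (1 - amp u (Suc t) w - amp u (Suc t) (c w)) / 2 - amp u t w"
    if "w \<in> pverts G" for w t
    using amp_Suc_Suc[OF that] sum_nbrs[OF that] assms(1) by simp
  have y2: "amp u (Suc (Suc 0)) w = (1 - 3 * amp u 0 w + amp u 0 (c w)) / 4" if "w \<in> pverts G" for w
    using that antipode[OF that] by (simp add: yS y1 field_simps)
  have y3: "amp u (Suc (Suc (Suc 0))) w = (amp u 0 w + amp u 0 (c w)) / 2" if "w \<in> pverts G" for w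
    using that antipode[OF that] by (simp add: yS[of _ "Suc 0"] y1 y2 field_simps)
  have y4: "amp u (Suc (Suc (Suc (Suc 0)))) w = (1 + amp u 0 w - 3 * amp u 0 (c w)) / 4"
    if "w \<in> pverts G" for w
    using that antipode[OF that] by (simp add: yS[of _ "Suc (Suc 0)"] y2 y3 field_simps)
  have y5: "amp u (Suc (Suc (Suc (Suc (Suc 0))))) w = (1 - amp u 0 w - amp u 0 (c w)) / 4"
    if "w \<in> pverts G" for w
    using that antipode[OF that] by (simp add: yS[of _ "Suc (Suc (Suc 0))"] y3 y4 field_simps)
  have isd: "isd = 1 / 2"
    by (subst isd_def) (simp add: assms(1))
  show ?thesis
  proof (rule perfect_state_transferI[where t = 6])
    show "u \<in> pverts G" "c u \<in> pverts G" "u \<noteq> c u"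
      using u antipode[OF u] by auto
    fix a b assume ab: "(a, b) \<in> parcs G"
    then have ba: "(b, a) \<in> parcs G" and V: "a \<in> pverts G" "b \<in> pverts G"
      using arc_sym by (auto dest: in_arcsD1 in_arcsD2)
    \<comment> \<open>Here 2 \<open>isd\<close> = 1, and two steps return to the same arc, so three
      double steps lead from time 6 back to time 0.\<close>
    have walk: "walk u (Suc (Suc t)) (a, b) = amp u (Suc t) a - amp u t b + walk u t (a, b)" for t
      by (simp add: walk_Suc[OF ab] walk_Suc[OF ba] isd)
    have "6 = Suc (Suc (Suc (Suc (Suc (Suc 0)))))"
      by simp
    then have "walk u 6 (a, b) = amp u (Suc (Suc (Suc (Suc (Suc 0))))) a
      - amp u (Suc (Suc (Suc (Suc 0)))) b + (amp u (Suc (Suc (Suc 0))) a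
      - amp u (Suc (Suc 0)) b + (amp u (Suc 0) a - amp u 0 b + walk u 0 (a, b)))"
      by (simp only: walk)
    \<comment> \<open>The three amplitudes at a sum to 1/2 whatever the initial values are, so only
      b and its antipode remain.\<close>
    also have "\<dots> = amp u 0 (c b) / 2 - amp u 0 b / 2 + walk u 0 (a, b)"
      unfolding y1[OF V(1)] y2[OF V(2)] y3[OF V(1)] y4[OF V(2)] y5[OF V(1)]
      by (simp add: field_simps)
    also have "\<dots> = amp u 0 (c b) / 2"
      using u ab V by (simp add: walk_0 amp_0 isd)
    also have "\<dots> = (if b = c u then isd else 0)"
    proof -
      have "c b = u \<longleftrightarrow> b = c u" "c b \<in> pverts G"
        using antipode[OF u] antipode[OF V(2)] by auto
      then show ?thesis
        using u by (simp add: amp_0 isd)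
    qed
    finally show "walk u 6 (a, b) = (if b = c u then isd else 0)" .
  qed simp
qed

end


section \<open>Eigenvectors of generalized Johnson graphs\<close>

text \<open>B splits into its part inside A and its part outside, chosen independently. Avoiding X
  only shrinks the two ground sets and keeps the lower binomial indices. Empty, one-point and
  two-point X give the degree and the two eigenvalues.\<close>

lemma card_subsets_avoiding:
  assumes "finite U" "A \<subseteq> U" "i \<le> k"
  shows "card {B. B \<subseteq> U \<and> card B = k \<and> card (A \<inter> B) = i \<and> B \<inter> X = {}} =
    (card (A - X) choose i) * (card (U - A - X) choose (k - i))"
proof -
  let ?S = "{I. I \<subseteq> A - X \<and> card I = i}" and ?T = "{J. J \<subseteq> U - A - X \<and> card J = k - i}"
  let ?R = "{B. B \<subseteq> U \<and> card B = k \<and> card (A \<inter> B) = i \<and> B \<inter> X = {}}"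
  have finA: "finite A"
    using assms finite_subset by blast
  have "bij_betw (\<lambda>(I, J). I \<union> J) (?S \<times> ?T) ?R"
  proof (rule bij_betw_byWitness[where f' = "\<lambda>B. (A \<inter> B, B - A)"])
    show "(\<lambda>(I, J). I \<union> J) ` (?S \<times> ?T) \<subseteq> ?R"
    proof (rule image_subsetI)
      fix x assume "x \<in> ?S \<times> ?T"
      then obtain I J where x: "x = (I, J)" and I: "I \<subseteq> A - X" "card I = i"
        and J: "J \<subseteq> U - A - X" "card J = k - i"
        by blast
      have fin: "finite I" "finite J"
        using I(1) J(1) finA assms(1) by (auto intro: finite_subset)
      have disj: "I \<inter> J = {}" and int: "A \<inter> (I \<union> J) = I"
        using I(1) J(1) by fast+
      show "(case x of (I, J) \<Rightarrow> I \<union> J) \<in> ?R"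
        unfolding x prod.case
      proof (intro CollectI conjI)
        show "card (I \<union> J) = k"
          using fin disj I(2) J(2) assms(3) by (simp add: card_Un_disjoint)
        show "card (A \<inter> (I \<union> J)) = i"
          by (simp only: int I(2))
        show "I \<union> J \<subseteq> U" "(I \<union> J) \<inter> X = {}"
          using I(1) J(1) assms(2) by fast+
      qed
    qed
    show "(\<lambda>B. (A \<inter> B, B - A)) ` ?R \<subseteq> ?S \<times> ?T"
    proof (rule image_subsetI)
      fix B assume "B \<in> ?R"
      then have B: "B \<subseteq> U" "card B = k" "card (A \<inter> B) = i" "B \<inter> X = {}"
        by auto
      have "finite B"
        using B(1) assms(1) finite_subset by blast
      then have "card (B - A) = card B - card (A \<inter> B)"
        by (simp add: card_Diff_subset_Int Int_commute)
      then show "(A \<inter> B, B - A) \<in> ?S \<times> ?T"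
        using B by blast
    qed
    show "\<forall>p\<in>?S \<times> ?T. (A \<inter> (case p of (I, J) \<Rightarrow> I \<union> J), (case p of (I, J) \<Rightarrow> I \<union> J) - A) = p"
      by fastforce
    show "\<forall>B\<in>?R. (case (A \<inter> B, B - A) of (I, J) \<Rightarrow> I \<union> J) = B"
      by auto
  qed
  then have "card ?R = card (?S \<times> ?T)"
    by (rule bij_betw_same_card[symmetric])
  also have "\<dots> = card ?S * card ?T"
    by (rule card_cartesian_product)
  also have "card ?S = card (A - X) choose i"
    using finA by (intro n_subsets) simp
  also have "card ?T = card (U - A - X) choose (k - i)"
    using assms(1) by (intro n_subsets) simp
  finally show ?thesis .
qed

lemma pverts_johnson: "pverts (generalized_johnson_graph n k i) = {A. A \<subseteq> {1..n} \<and> card A = k}"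
  by (simp add: generalized_johnson_graph_def)

lemma nbrs_johnson:
  assumes "i < k" "A \<in> pverts (generalized_johnson_graph n k i)"
  shows "nbrs (generalized_johnson_graph n k i) A =
    {B. B \<subseteq> {1..n} \<and> card B = k \<and> card (A \<inter> B) = i}"
  using assms by (auto simp: nbrs_def generalized_johnson_graph_def Let_def)

lemma sum_nbrs_johnson_avoiding:
  assumes "i < k" and A: "A \<in> pverts (generalized_johnson_graph n k i)"
  shows "(\<Sum>B\<in>nbrs (generalized_johnson_graph n k i) A. of_bool (B \<inter> X = {})) =
    (of_nat ((card (A - X) choose i) * (card ({1..n} - A - X) choose (k - i))) :: 'a::semiring_1)"
proof -
  let ?N = "nbrs (generalized_johnson_graph n k i) A"
  have "finite ?N"
    unfolding nbrs_johnson[OF assms] by simp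
  moreover have "?N \<inter> {B. B \<inter> X = {}} =
      {B. B \<subseteq> {1..n} \<and> card B = k \<and> card (A \<inter> B) = i \<and> B \<inter> X = {}}"
    unfolding nbrs_johnson[OF assms] by auto
  moreover have "card \<dots> = (card (A - X) choose i) * (card ({1..n} - A - X) choose (k - i))"
    using assms by (intro card_subsets_avoiding) (auto simp: pverts_johnson)
  ultimately show ?thesis
    by (simp add: sum_of_bool_eq)
qed

lemma regular_pair_graph_johnson:
  assumes "2 * k \<le> n" "i < k"
  shows "regular_pair_graph (generalized_johnson_graph n k i) ((k choose i) * ((n - k) choose (k - i)))"
proof -
  interpret pair_graph "generalized_johnson_graph n k i"
    by (rule pair_graph_generalized_johnson_graph)
  show ?thesis
  proof
    show "(k choose i) * ((n - k) choose (k - i)) > 0"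
      using assms by simp
    fix A assume A: "A \<in> pverts (generalized_johnson_graph n k i)"
    then have "card ({1..n} - A) = n - k"
      by (auto simp: pverts_johnson card_Diff_subset finite_subset)
    then show "card (nbrs (generalized_johnson_graph n k i) A) = (k choose i) * ((n - k) choose (k - i))"
      using sum_nbrs_johnson_avoiding[OF assms(2) A, of "{}", where 'a = nat] A
      by (simp add: pverts_johnson)
  qed
qed

text \<open>The number of neighbours avoiding x depends only on whether x lies in A. In a difference
  of two such counts the constant part cancels, and the gap between the two possible values is the
  eigenvalue. Integers prevent truncated subtraction.\<close>

lemma johnson_eigenvector_linear:
  fixes a b :: nat
  assumes "i < k" and A: "A \<in> pverts (generalized_johnson_graph n k i)"
    and ab: "a \<in> {1..n}" "b \<in> {1..n}"
  shows "(\<Sum>B\<in>nbrs (generalized_johnson_graph n k i) A. of_bool (a \<notin> B) - of_bool (b \<notin> B)) =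
    (of_int (int (k choose i) * int ((n - k - 1) choose (k - i))
      - int ((k - 1) choose i) * int ((n - k) choose (k - i))) :: 'a::comm_ring_1)
    * (of_bool (a \<notin> A) - of_bool (b \<notin> A))"
proof -
  have A': "A \<subseteq> {1..n}" "card A = k" "finite A" "card ({1..n} - A) = n - k"
    using A by (auto simp: pverts_johnson card_Diff_subset finite_subset)
  have "(\<Sum>B\<in>nbrs (generalized_johnson_graph n k i) A. of_bool (x \<notin> B)) =
      (of_int (if x \<in> A then int ((k - 1) choose i) * int ((n - k) choose (k - i))
        else int (k choose i) * int ((n - k - 1) choose (k - i))) :: 'a)" if "x \<in> {1..n}" for x
  proof -
    have "card (A - {x}) = (if x \<in> A then k - 1 else k)"
      "card ({1..n} - A - {x}) = (if x \<in> A then n - k else n - k - 1)"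
      using that A' by (auto simp: card_Diff_singleton_if)
    then show ?thesis
      using sum_nbrs_johnson_avoiding[OF assms(1) A, of "{x}", where 'a = 'a] by simp
  qed
  then show ?thesis
    using ab by (simp add: sum_subtractf)
qed

text \<open>For distinct x and y the number of neighbours avoiding both is \<open>N0\<close>,
  \<open>N1\<close> or \<open>N2\<close>, by how many of the two lie in A. The alternating sum over
  four pairs kills constant and linear parts and leaves the second difference. The inequalities keep
  each pair genuinely two-element.\<close>

lemma johnson_eigenvector_quadratic:
  fixes a b c e :: nat
  assumes "i < k" and A: "A \<in> pverts (generalized_johnson_graph n k i)"
    and abce: "{a, b, c, e} \<subseteq> {1..n}" "a \<noteq> c" "a \<noteq> e" "b \<noteq> c" "b \<noteq> e"
  shows "(\<Sum>B\<in>nbrs (generalized_johnson_graph n k i) A.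
      (of_bool (a \<notin> B) - of_bool (b \<notin> B)) * (of_bool (c \<notin> B) - of_bool (e \<notin> B))) =
    (of_int (int ((k - 2) choose i) * int ((n - k) choose (k - i))
      - 2 * int ((k - 1) choose i) * int ((n - k - 1) choose (k - i))
      + int (k choose i) * int ((n - k - 2) choose (k - i))) :: 'a::comm_ring_1)
    * ((of_bool (a \<notin> A) - of_bool (b \<notin> A)) * (of_bool (c \<notin> A) - of_bool (e \<notin> A)))"
proof -
  let ?N = "nbrs (generalized_johnson_graph n k i) A"
  define N0 N1 N2 where "N0 = int (k choose i) * int ((n - k - 2) choose (k - i))"
    and "N1 = int ((k - 1) choose i) * int ((n - k - 1) choose (k - i))"
    and "N2 = int ((k - 2) choose i) * int ((n - k) choose (k - i))"
  have A': "A \<subseteq> {1..n}" "card A = k" "finite A" "card ({1..n} - A) = n - k"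
    using A by (auto simp: pverts_johnson card_Diff_subset finite_subset)
  have pair: "(\<Sum>B\<in>?N. of_bool (x \<notin> B) * of_bool (y \<notin> B)) =
      (of_int (if x \<in> A \<and> y \<in> A then N2
        else if x \<in> A \<or> y \<in> A then N1
        else N0) :: 'a)"
    if "x \<in> {1..n}" "y \<in> {1..n}" "x \<noteq> y" for x y
  proof -
    have "card (A - {x, y}) = (if x \<in> A \<and> y \<in> A then k - 2 else if x \<in> A \<or> y \<in> A then k - 1 else k)"
      "card ({1..n} - A - {x, y}) =
        (if x \<in> A \<and> y \<in> A then n - k else if x \<in> A \<or> y \<in> A then n - k - 1 else n - k - 2)"
      unfolding Diff_insert2[of _ x "{y}"] using that A' by (auto simp: card_Diff_singleton_if)
    moreover have "(\<Sum>B\<in>?N. of_bool (x \<notin> B) * of_bool (y \<notin> B)) = (\<Sum>B\<in>?N. of_bool (B \<inter> {x, y} = {}) :: 'a)"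
      by (intro sum.cong) auto
    ultimately show ?thesis
      using sum_nbrs_johnson_avoiding[OF assms(1) A, of "{x, y}", where 'a = 'a]
      by (auto simp: N0_def N1_def N2_def)
  qed
  have "(\<Sum>B\<in>?N. (of_bool (a \<notin> B) - of_bool (b \<notin> B)) * (of_bool (c \<notin> B) - of_bool (e \<notin> B))) =
    (\<Sum>B\<in>?N. of_bool (a \<notin> B) * of_bool (c \<notin> B)) - (\<Sum>B\<in>?N. of_bool (a \<notin> B) * of_bool (e \<notin> B))
    - (\<Sum>B\<in>?N. of_bool (b \<notin> B) * of_bool (c \<notin> B)) + (\<Sum>B\<in>?N. of_bool (b \<notin> B) * of_bool (e \<notin> B) :: 'a)"
    by (simp add: left_diff_distrib right_diff_distrib sum_subtractf del: of_bool_not_iff)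
  also have "\<dots> = of_int (N2 - 2 * N1 + N0)
    * ((of_bool (a \<notin> A) - of_bool (b \<notin> A)) * (of_bool (c \<notin> A) - of_bool (e \<notin> A)))"
  proof -
    have "a \<in> {1..n}" "b \<in> {1..n}" "c \<in> {1..n}" "e \<in> {1..n}"
      using abce(1) by simp_all
    then show ?thesis
      by (simp only: pair abce not_False_eq_True)
        (cases "a \<in> A"; cases "b \<in> A"; cases "c \<in> A"; cases "e \<in> A"; simp)
  qed
  finally show ?thesis
    by (simp add: N0_def N1_def N2_def mult.assoc)
qed


section \<open>Perfect state transfer forces small parameters\<close>

text \<open>This is the arithmetic for n = 2k, with m1 and m2 the doubled normalized eigenvalues.
  Integrality of m1 says that 4i/k is an integer, so i/k is 0, 1/4, 1/2 or 3/4; integrality of m2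
  excludes the quarters and leaves only k = 2 for one half.\<close>

lemma johnson_parameters:
  fixes k i :: nat and m1 m2 :: int
  assumes k: "i < k"
    and m1: "2 * (int (k choose i) * int ((k - 1) choose (k - i))
      - int ((k - 1) choose i) * int (k choose (k - i))) =
      m1 * int ((k choose i) * (k choose (k - i)))"
    and m2: "k \<ge> 2 \<Longrightarrow> 2 * (int ((k - 2) choose i) * int (k choose (k - i))
      - 2 * int ((k - 1) choose i) * int ((k - 1) choose (k - i))
      + int (k choose i) * int ((k - 2) choose (k - i))) =
      m2 * int ((k choose i) * (k choose (k - i)))"
  shows "i = 0 \<or> (k = 2 \<and> i = 1)"
proof -
  define K I c p q where "K = int k" and "I = int i" and "c = int (k choose i)"
    and "p = int ((k - 1) choose i)" and "q = int ((k - 1) choose (k - i))"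
  have c: "c > 0" "int (k choose (k - i)) = c"
    using k binomial_symmetric[of i k] by (simp_all add: c_def)
  have IK: "0 \<le> I" "I < K"
    using k by (simp_all add: I_def K_def)
  have p: "K * p = (K - I) * c"
    using arg_cong[OF binomial_absorb_comp[of k i], of int] k
    by (simp add: K_def I_def c_def p_def of_nat_diff)
  have q: "K * q = I * c"
    using arg_cong[OF binomial_absorb_comp[of k "k - i"], of int] k c
    by (simp add: K_def I_def c_def q_def of_nat_diff)
  have "K * (2 * (c * q - p * c)) = K * (m1 * (c * c))"
    using m1 c(2) unfolding c_def[symmetric] p_def[symmetric] q_def[symmetric] by (simp add: c_def)
  then have "2 * (c * (K * q) - (K * p) * c) = K * m1 * (c * c)"
    by (simp add: algebra_simps)
  then have "(2 * (2 * I - K)) * (c * c) = (K * m1) * (c * c)"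
    unfolding p q by (simp add: algebra_simps)
  then have "2 * (2 * I - K) = K * m1"
    using c by simp
  then have I4: "4 * I = K * (m1 + 2)"
    by (simp add: algebra_simps)
  have "0 \<le> m1 + 2"
    using I4 IK by (metis mult_nonneg_nonneg zero_le_mult_iff zero_le_numeral not_less order_le_less_trans order_less_le)
  moreover have "m1 + 2 < 4"
  proof (rule ccontr)
    assume "\<not> m1 + 2 < 4"
    then have "K * 4 \<le> K * (m1 + 2)"
      using IK by (intro mult_left_mono) auto
    then show False
      using I4 IK by linarith
  qed
  ultimately consider "m1 + 2 = 0" | "m1 + 2 = 1" | "m1 + 2 = 2" | "m1 + 2 = 3"
    by linarith
  then have cases: "I = 0 \<or> K = 4 * I \<or> K = 2 * I \<or> 4 * I = 3 * K"
    using I4 by cases auto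
  show ?thesis
  proof (cases "I = 0")
    case True
    then show ?thesis by (simp add: I_def)
  next
    case False
    with IK have k2: "k \<ge> 2" and I1: "I \<ge> 1"
      by (auto simp: I_def K_def)
    define r s where "r = int ((k - 2) choose i)" and "s = int ((k - 2) choose (k - i))"
    have r: "(K - 1) * r = (K - 1 - I) * p"
    proof -
      have "int (k - 1 - i) * p = int (k - 1) * r"
        using binomial_absorb_comp[of "k - 1" i] unfolding p_def r_def
        by (metis diff_diff_left of_nat_mult one_add_one)
      moreover have "int (k - 1 - i) = K - 1 - I" "int (k - 1) = K - 1"
        using k by (auto simp: K_def I_def)
      ultimately show ?thesis
        by simp
    qed
    have s: "(K - 1) * s = (I - 1) * q"
      using arg_cong[OF binomial_absorb_comp[of "k - 1" "k - i"], of int] k k2 I1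
      by (simp add: K_def I_def s_def q_def of_nat_diff numeral_2_eq_2)
    have r': "K * (K - 1) * r = (K - 1 - I) * (K - I) * c"
      using p r by (metis mult.assoc mult.left_commute)
    have s': "K * (K - 1) * s = (I - 1) * I * c"
      using q s by (metis mult.assoc mult.left_commute)
    have "2 * (r * c - 2 * p * q + c * s) = m2 * (c * c)"
      using m2[OF k2] c(2) unfolding c_def[symmetric] p_def[symmetric] q_def[symmetric]
        r_def[symmetric] s_def[symmetric] by (simp add: c_def)
    \<comment> \<open>This factor is what the absorption identities need to turn p, q, r and s into
      polynomials in K and I times c.\<close>
    then have "K * K * (K - 1) * (2 * (r * c - 2 * p * q + c * s)) = K * K * (K - 1) * (m2 * (c * c))"
      by simp
    then have "2 * (K * (K * (K - 1) * r) * c - 2 * (K - 1) * (K * p) * (K * q) + K * (K * (K - 1) * s) * c) =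
        K * K * (K - 1) * m2 * (c * c)"
      by (simp add: algebra_simps)
    then have "(2 * (K * (K - 1 - I) * (K - I) - 2 * (K - 1) * (K - I) * I + K * (I - 1) * I)) * (c * c) =
        (K * K * (K - 1) * m2) * (c * c)"
      unfolding r' s' p q by (simp add: algebra_simps)
    then have main: "2 * (K * (K - 1 - I) * (K - I) - 2 * (K - 1) * (K - I) * I + K * (I - 1) * I) =
        K * K * (K - 1) * m2"
      using c by simp
    \<comment> \<open>The left side of \<open>main\<close> is invariant under replacing I by K - I,
      so both choices of I give one equation; after cancelling 4 J^2 it equates an odd number with
      an even one.\<close>
    have quarter: False
      if "K = 4 * J" "I = J \<or> I = 3 * J" for J
    proof -
      have "J > 0"
        using that IK I1 by auto
      have "(4 * J * J) * (8 * J - 5) = (4 * J * J) * (4 * (4 * J - 1) * m2)"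
        using main that by (auto simp: algebra_simps)
      then have "8 * J - 5 = 4 * (4 * J - 1) * m2"
        using \<open>J > 0\<close> by simp
      then have "even (8 * J - 5)"
        by simp
      then show False
        by simp
    qed
    have "K = 2 * I"
    proof (rule ccontr)
      assume "K \<noteq> 2 * I"
      with cases False consider "K = 4 * I" | "4 * I = 3 * K"
        by blast
      then show False
      proof cases
        case 1
        then show False
          using quarter by blast
      next
        case 2
        then have "4 dvd K"
          by presburger
        then obtain J where "K = 4 * J" ..
        with 2 show False
          using quarter by simp
      qed
    qed
    have "(4 * I * I) * (- 1) = (4 * I * I) * ((2 * I - 1) * m2)"
      using main unfolding \<open>K = 2 * I\<close> by (simp add: algebra_simps)
    moreover have "4 * I * I \<noteq> 0"
      using I1 by simp
    ultimately have "- 1 = (2 * I - 1) * m2"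
      by (metis mult_left_cancel)
    then have "(2 * I - 1) dvd 1"
      by (metis dvd_minus_iff dvd_triv_left)
    then have "I = 1"
      using I1 by simp
    then show ?thesis
      using \<open>K = 2 * I\<close> by (simp add: K_def I_def)
  qed
qed


lemma perfect_state_transfer_johnson_parameters:
  assumes nk: "n \<ge> 2 * k" and ik: "i < k"
    and pst: "grover_perfect_state_transfer (generalized_johnson_graph n k i)"
  shows "n = 2 * k \<and> (i = 0 \<or> (k = 2 \<and> i = 1))"
proof -
  let ?J = "generalized_johnson_graph n k i"
  define d where "d = (k choose i) * ((n - k) choose (k - i))"
  interpret regular_pair_graph ?J d
    unfolding d_def by (rule regular_pair_graph_johnson[OF nk ik])
  obtain u v t where u: "u \<in> pverts ?J" and v: "v \<in> pverts ?J" and "u \<noteq> v" "t > 0"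
    and uv: "\<And>(f :: nat set \<Rightarrow> complex) l. (\<And>w. w \<in> pverts ?J \<Longrightarrow> (\<Sum>z\<in>nbrs ?J w. f z) = of_nat d * l * f w) \<Longrightarrow>
       f v = chebyshev t l * f u"
    using perfect_state_transfer_eigenvector[OF pst] by blast
  \<comment> \<open>Here m is an eigenvalue of the adjacency matrix itself, hence the division by
    d.\<close>
  have uv': "f v = chebyshev t (of_int m / of_nat d) * f u"
    if "\<And>w. w \<in> pverts ?J \<Longrightarrow> (\<Sum>z\<in>nbrs ?J w. f z) = of_int m * f w"
    for f :: "nat set \<Rightarrow> complex" and m :: int
    using that d_pos by (intro uv) simp
  have integral: "\<exists>r. 2 * m = r * int d"
    if "chebyshev t (of_int m / of_nat d :: complex) \<in> \<int>" for m :: int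
  proof -
    have "2 * (of_int m / of_nat d :: complex) \<in> \<int>"
      using that \<open>t > 0\<close> by (intro chebyshev_integral) auto
    then obtain r where "2 * (of_int m / of_nat d :: complex) = of_int r"
      by (auto elim: Ints_cases)
    then have "of_int (2 * m) = (of_int (r * int d) :: complex)"
      using d_pos by (simp add: field_simps)
    then show ?thesis
      by (metis of_int_eq_iff)
  qed
  have u': "u \<subseteq> {1..n}" "card u = k" "finite u" and v': "v \<subseteq> {1..n}" "card v = k" "finite v"
    using u v by (auto simp: pverts_johnson finite_subset)
  define m1 where "m1 = int (k choose i) * int ((n - k - 1) choose (k - i))
      - int ((k - 1) choose i) * int ((n - k) choose (k - i))"
  define T1 :: complex where "T1 = chebyshev t (of_int m1 / of_nat d)"
  have lin: "of_bool (a \<notin> v) - of_bool (b \<notin> v) = T1 * (of_bool (a \<notin> u) - of_bool (b \<notin> u))"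
    if "a \<in> {1..n}" "b \<in> {1..n}" for a b
    unfolding T1_def m1_def
    by (rule uv'[of "\<lambda>A. of_bool (a \<notin> A) - of_bool (b \<notin> A)"])
      (rule johnson_eigenvector_linear[OF ik _ that])
  \<comment> \<open>Distinct sets of equal finite size do not contain one another, so both
    differences are nonempty.\<close>
  obtain a where a: "a \<in> u" "a \<notin> v"
    using u' v' \<open>u \<noteq> v\<close> by (metis card_subset_eq subsetI)
  obtain b where b: "b \<in> v" "b \<notin> u"
    using u' v' \<open>u \<noteq> v\<close> by (metis card_subset_eq subsetI)
  have ab: "a \<in> {1..n}" "b \<in> {1..n}"
    using a b u' v' by blast+
  have "1 = - T1"
    using lin[OF ab] a b by simp
  then have T1: "T1 = - 1"
    by (simp add: equation_minus_iff)
  \<comment> \<open>With \<open>T1\<close> = -1, comparing any c with the fixed a shows that exactly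
    one of u and v contains c.\<close>
  have "c \<in> u \<longleftrightarrow> c \<notin> v" if "c \<in> {1..n}" for c
    using lin[OF ab(1) that] a T1 by (cases "c \<in> u"; cases "c \<in> v") auto
  then have compl: "v = {1..n} - u"
    using u' v' by blast
  then have n: "n = 2 * k"
    using u' v' nk by (auto simp: card_Diff_subset)
  obtain r1 where r1: "2 * m1 = r1 * int d"
    using integral[of m1] T1 unfolding T1_def by auto
  have "\<exists>r2. 2 * (int ((k - 2) choose i) * int (k choose (k - i))
      - 2 * int ((k - 1) choose i) * int ((k - 1) choose (k - i))
      + int (k choose i) * int ((k - 2) choose (k - i))) = r2 * int d" if "k \<ge> 2"
  proof (rule integral)
    let ?m = "int ((k - 2) choose i) * int (k choose (k - i))
      - 2 * int ((k - 1) choose i) * int ((k - 1) choose (k - i))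
      + int (k choose i) * int ((k - 2) choose (k - i))"
    \<comment> \<open>A second point c of u and a second point e of v exist because k is at least 2.
      Both factors change sign from u to its complement v, so the product is unchanged and the
      Chebyshev value is 1.\<close>
    have "u - {a} \<noteq> {}"
      using that u' a by (intro card_gt_0_iff[THEN iffD1, THEN conjunct1]) simp
    then obtain c where c: "c \<in> u" "c \<noteq> a"
      by blast
    have "v - {b} \<noteq> {}"
      using that v' b by (intro card_gt_0_iff[THEN iffD1, THEN conjunct1]) simp
    then obtain e where e: "e \<in> v" "e \<noteq> b"
      by blast
    have abce: "{a, b, c, e} \<subseteq> {1..n}" "a \<noteq> c" "a \<noteq> e" "b \<noteq> c" "b \<noteq> e"
      using a b c e u' v' by auto
    let ?f = "\<lambda>A. (of_bool (a \<notin> A) - of_bool (b \<notin> A)) * (of_bool (c \<notin> A) - of_bool (e \<notin> A)) :: complex"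
    have nn: "n - k = k"
      using n by simp
    have "?f v = chebyshev t (of_int ?m / of_nat d) * ?f u"
      by (rule uv'[of ?f]) (rule johnson_eigenvector_quadratic[OF ik _ abce, unfolded nn])
    then have "chebyshev t (of_int ?m / of_nat d :: complex) = 1"
      using a b c e compl by auto
    then show "chebyshev t (of_int ?m / of_nat d :: complex) \<in> \<int>"
      by simp
  qed
  then obtain r2 where r2: "k \<ge> 2 \<Longrightarrow> 2 * (int ((k - 2) choose i) * int (k choose (k - i))
      - 2 * int ((k - 1) choose i) * int ((k - 1) choose (k - i))
      + int (k choose i) * int ((k - 2) choose (k - i))) = r2 * int d"
    by blast
  have "i = 0 \<or> (k = 2 \<and> i = 1)"
    by (rule johnson_parameters[OF ik, of r1 r2])
      (use r1 r2 n in \<open>simp_all add: m1_def d_def\<close>)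
  with n show ?thesis by simp
qed

section \<open>The two families that do admit transfer\<close>

lemma perfect_state_transfer_johnson_0:
  assumes "k > 0"
  shows "grover_perfect_state_transfer (generalized_johnson_graph (2 * k) k 0)"
proof -
  interpret regular_pair_graph "generalized_johnson_graph (2 * k) k 0" "(k choose 0) * ((2 * k - k) choose (k - 0))"
    using assms by (intro regular_pair_graph_johnson) auto
  show ?thesis
    \<comment> \<open>Each k-set is disjoint from only one other, its complement, so the degree is 1
      and any vertex can serve as u.\<close>
    by (rule perfect_state_transfer_matching[where u = "{1..k}"]) (auto simp: pverts_johnson)
qed

text \<open>Two 2-subsets of a 4-set meet in one point unless they are equal or complementary, so
  complementation is the antipodal map of an octahedron.\<close>

lemma perfect_state_transfer_johnson_4_2_1:
  "grover_perfect_state_transfer (generalized_johnson_graph 4 2 1)"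
proof -
  let ?J = "generalized_johnson_graph 4 2 1"
  interpret regular_pair_graph ?J "(2 choose 1) * ((4 - 2) choose (2 - 1))"
    by (rule regular_pair_graph_johnson) auto
  show ?thesis
  proof (rule perfect_state_transfer_octahedron[where u = "{1..2}" and c = "\<lambda>w. {1..4} - w"])
    show "{1..2} \<in> pverts ?J"
      by (auto simp: pverts_johnson)
    fix w assume w: "w \<in> pverts ?J"
    then have w': "w \<subseteq> {1..4}" "card w = 2" "finite w"
      by (auto simp: pverts_johnson finite_subset)
    then have cw: "card ({1..4} - w) = 2"
      by (simp add: card_Diff_subset)
    show "{1..4} - w \<in> pverts ?J \<and> {1..4} - w \<noteq> w \<and> {1..4} - ({1..4} - w) = w"
    proof (intro conjI)
      obtain x where "x \<in> w"
        using w' by fastforce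
      then show "{1..4} - w \<noteq> w"
        by blast
    qed (use w' cw in \<open>auto simp: pverts_johnson\<close>)
    have "card (w \<inter> B) = 1 \<longleftrightarrow> B \<noteq> w \<and> B \<noteq> {1..4} - w" if B: "B \<subseteq> {1..4}" "card B = 2" for B
    proof -
      have fin: "finite B"
        using B(1) finite_subset by blast
      have "card (w \<inter> B) \<le> 2"
        using w' by (metis card_mono inf_le1)
      moreover have "card (w \<inter> B) = 2 \<longleftrightarrow> B = w"
        using w' B fin by (metis card_subset_eq inf.idem inf_le1 inf_le2)
      moreover have "card (w \<inter> B) = 0 \<longleftrightarrow> B = {1..4} - w"
      proof
        assume "card (w \<inter> B) = 0"
        then have "B \<subseteq> {1..4} - w"
          using w'(3) B by auto
        then show "B = {1..4} - w"
          using B(2) cw by (intro card_subset_eq) auto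
      qed auto
      ultimately show ?thesis
        by auto
    qed
    then show "nbrs ?J w = pverts ?J - {w, {1..4} - w}"
      using w by (subst nbrs_johnson) (auto simp: pverts_johnson)
  qed simp
qed

theorem theorem3p14:
  fixes n k i :: nat
  assumes "n > 0" and "k > 0" and "n \<ge> 2 * k" and "i \<le> k - 1"
  shows "grover_perfect_state_transfer (generalized_johnson_graph n k i) \<longleftrightarrow>
           (n, k, i) = (2 * k, k, 0) \<or> (n, k, i) = (4, 2, 1)"
proof -
  \<comment> \<open>Subtraction on naturals truncates, so this step relies on k > 0.\<close>
  have "i < k"
    using assms(2,4) by linarith
  then show ?thesis
    using assms(2,3) perfect_state_transfer_johnson_parameters[of k n i]
      perfect_state_transfer_johnson_0[of k] perfect_state_transfer_johnson_4_2_1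
    by auto
qed

end
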